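(* Let $(I,\tilde g,V,\lambda,\mu)$ be an almost $\eta$-Ricci soliton with $V=\frac{\partial}{\partial x^3}$. Suppose that $f_1=f_1(x^2)$ depends only on $x^2$, $f_2=f_2(x^1)$ depends only on $x^1$, that the components of $\eta=\sum_{k=1}^3\eta^ke_k$ are all equal, $\eta^1=\eta^2=\eta^3=:f$, and that $\mu$ is nowhere zero on $I$. Then $\eta=0$ and $\lambda=0$. Moreover, $$\frac{f_1''f_1-2(f_1')^2}{f_1^4}=-\frac{f_2''f_2-2(f_2')^2}{f_2^4}=\text{constant}$$ on $I$ (i.e. the two expressions are equal to one and the same real constant).
   Context: Let $I=I_1\times I_2\times I_3\subseteq\mathbb R^3$ with $I_1,I_2,I_3\subseteq\mathbb R$ open intervals and standard coordinates $x^1,x^2,x^3$. Let $f_1,f_2$ be smooth nowhere zero functions on $I$ and endow $I$ with the Riemannian metric $\tilde g=\frac{1}{f_1^2}dx^1\otimes dx^1+\frac{1}{f_2^2}dx^2\otimes dx^2+dx^3\otimes dx^3$. Let $E_1=f_1\frac{\partial}{\partial x^1}$, $E_2=f_2\frac{\partial}{\partial x^2}$, $E_3=\frac{\partial}{\partial x^3}$ (an orthonormal frame), and let $e_1,e_2,e_3$ be the dual $1$-forms. For a smooth vector field $V$, a $1$-form $\eta$, and smooth functions $\lambda,\mu$ on $I$ with $\mu\neq0$, $(I,\tilde g,V,\lambda,\mu)$ is an almost $\eta$-Ricci soliton if $\frac12\pounds_V\tilde g+\mathrm{Ric}+\lambda\tilde g+\mu\,\eta\otimes\eta=0$ on $I$,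 where $\pounds_V\tilde g$ is the Lie derivative of $\tilde g$ along $V$ and $\mathrm{Ric}$ is the Ricci tensor of $\tilde g$, with $\mathrm{Ric}(Y,Z)=\sum_{k}\tilde g(R(E_k,Y)Z,E_k)$, $R(X,Y)Z=\nabla_X\nabla_YZ-\nabla_Y\nabla_XZ-\nabla_{[X,Y]}Z$, $\nabla$ the Levi-Civita connection. A prime denotes the derivative of a function of a single variable with respect to that variable. *)

theory Defs
  imports "HOL-Analysis.Analysis"
begin

text \<open>Calculus on an open subset \<open>S\<close> of Euclidean space. Functions, vector fields and
  differential forms on \<open>S\<close> are represented by total functions of which only the values on
  \<open>S\<close> matter; since \<open>S\<close> is open, so do derivatives at points of \<open>S\<close>.\<close>

fun Ck_on :: "nat \<Rightarrow> 'a::real_normed_vector set \<Rightarrow> ('a \<Rightarrow> 'b::real_normed_vector) \<Rightarrow> bool" where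
  "Ck_on 0 S f \<longleftrightarrow> continuous_on S f"
| "Ck_on (Suc k) S f \<longleftrightarrow> (\<forall>p\<in>S. f differentiable (at p)) \<and>
      (\<forall>v. Ck_on k S (\<lambda>p. frechet_derivative f (at p) v))"

definition smooth_on :: "'a::real_normed_vector set \<Rightarrow> ('a \<Rightarrow> 'b::real_normed_vector) \<Rightarrow> bool" where
  "smooth_on S f \<longleftrightarrow> (\<forall>k. Ck_on k S f)"

text \<open>A vector field is given by its components in the frame of coordinate fields, a tensor
  field by its values on tangent vectors.\<close>

type_synonym vfield = "real^3 \<Rightarrow> real^3"
type_synonym one_form = "real^3 \<Rightarrow> real^3 \<Rightarrow> real"
type_synonym bilinear_field = "real^3 \<Rightarrow> real^3 \<Rightarrow> real^3 \<Rightarrow> real"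
type_synonym connection = "vfield \<Rightarrow> vfield \<Rightarrow> vfield"

definition smooth_one_form :: "(real^3) set \<Rightarrow> one_form \<Rightarrow> bool" where
  "smooth_one_form S \<eta> \<longleftrightarrow> (\<forall>p\<in>S. linear (\<eta> p)) \<and> (\<forall>v. smooth_on S (\<lambda>p. \<eta> p v))"

definition coord_field :: "3 \<Rightarrow> vfield" where
  "coord_field k = (\<lambda>p. axis k 1)"

definition vderiv :: "vfield \<Rightarrow> (real^3 \<Rightarrow> 'b::real_normed_vector) \<Rightarrow> real^3 \<Rightarrow> 'b" where
  "vderiv X h = (\<lambda>p. frechet_derivative h (at p) (X p))"

definition lie_bracket :: "vfield \<Rightarrow> vfield \<Rightarrow> vfield" where
  "lie_bracket X Y = (\<lambda>p. vderiv X Y p - vderiv Y X p)"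

definition lie_derivative :: "vfield \<Rightarrow> bilinear_field \<Rightarrow> vfield \<Rightarrow> vfield \<Rightarrow> real^3 \<Rightarrow> real" where
  "lie_derivative V g Y Z = (\<lambda>p. vderiv V (\<lambda>q. g q (Y q) (Z q)) p
      - g p (lie_bracket V Y p) (Z p) - g p (Y p) (lie_bracket V Z p))"

definition affine_connection :: "(real^3) set \<Rightarrow> connection \<Rightarrow> bool" where
  "affine_connection S D \<longleftrightarrow>
     (\<forall>X Y. smooth_on S X \<longrightarrow> smooth_on S Y \<longrightarrow> smooth_on S (D X Y)) \<and>
     (\<forall>X X' Y. smooth_on S X \<longrightarrow> smooth_on S X' \<longrightarrow> smooth_on S Y \<longrightarrow>
        (\<forall>p\<in>S. D (\<lambda>q. X q + X' q) Y p = D X Y p + D X' Y p)) \<and>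
     (\<forall>h X Y. smooth_on S h \<longrightarrow> smooth_on S X \<longrightarrow> smooth_on S Y \<longrightarrow>
        (\<forall>p\<in>S. D (\<lambda>q. h q *\<^sub>R X q) Y p = h p *\<^sub>R D X Y p)) \<and>
     (\<forall>X Y Y'. smooth_on S X \<longrightarrow> smooth_on S Y \<longrightarrow> smooth_on S Y' \<longrightarrow>
        (\<forall>p\<in>S. D X (\<lambda>q. Y q + Y' q) p = D X Y p + D X Y' p)) \<and>
     (\<forall>h X Y. smooth_on S h \<longrightarrow> smooth_on S X \<longrightarrow> smooth_on S Y \<longrightarrow>
        (\<forall>p\<in>S. D X (\<lambda>q. h q *\<^sub>R Y q) p = vderiv X h p *\<^sub>R Y p + h p *\<^sub>R D X Y p))"

text \<open>The Levi-Civita connection of \<open>g\<close>: the (on smooth fields over \<open>S\<close>, unique)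
  torsion-free affine connection compatible with \<open>g\<close>.\<close>

definition levi_civita :: "(real^3) set \<Rightarrow> bilinear_field \<Rightarrow> connection \<Rightarrow> bool" where
  "levi_civita S g D \<longleftrightarrow> affine_connection S D \<and>
     (\<forall>X Y. smooth_on S X \<longrightarrow> smooth_on S Y \<longrightarrow>
        (\<forall>p\<in>S. D X Y p - D Y X p = lie_bracket X Y p)) \<and>
     (\<forall>X Y Z. smooth_on S X \<longrightarrow> smooth_on S Y \<longrightarrow> smooth_on S Z \<longrightarrow>
        (\<forall>p\<in>S. vderiv X (\<lambda>q. g q (Y q) (Z q)) p = g p (D X Y p) (Z p) + g p (Y p) (D X Z p)))"

definition curvature :: "connection \<Rightarrow> vfield \<Rightarrow> vfield \<Rightarrow> vfield \<Rightarrow> vfield" where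
  "curvature D X Y Z = (\<lambda>p. D X (D Y Z) p - D Y (D X Z) p - D (lie_bracket X Y) Z p)"

text \<open>\<open>E\<close> is meant to be an orthonormal frame for \<open>g\<close>.\<close>

definition ricci :: "bilinear_field \<Rightarrow> connection \<Rightarrow> (3 \<Rightarrow> vfield) \<Rightarrow> vfield \<Rightarrow> vfield \<Rightarrow> real^3 \<Rightarrow> real" where
  "ricci g D E Y Z = (\<lambda>p. \<Sum>k\<in>UNIV. g p (curvature D (E k) Y Z p) (E k p))"

text \<open>The condition on \<open>\<mu>\<close> in the definition of a soliton is read as: \<open>\<mu>\<close> is not the zero
  function.\<close>

definition almost_eta_ricci_soliton ::
  "(real^3) set \<Rightarrow> bilinear_field \<Rightarrow> connection \<Rightarrow> (3 \<Rightarrow> vfield) \<Rightarrow> vfield \<Rightarrow> one_form \<Rightarrow>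
     (real^3 \<Rightarrow> real) \<Rightarrow> (real^3 \<Rightarrow> real) \<Rightarrow> bool" where
  "almost_eta_ricci_soliton S g D E V \<eta> lam \<mu> \<longleftrightarrow>
     smooth_on S V \<and> smooth_one_form S \<eta> \<and> smooth_on S lam \<and> smooth_on S \<mu> \<and> (\<exists>p\<in>S. \<mu> p \<noteq> 0) \<and>
     (\<forall>Y Z. smooth_on S Y \<longrightarrow> smooth_on S Z \<longrightarrow>
        (\<forall>p\<in>S. 1/2 * lie_derivative V g Y Z p + ricci g D E Y Z p
              + lam p * g p (Y p) (Z p) + \<mu> p * (\<eta> p (Y p) * \<eta> p (Z p)) = 0))"

definition box3 :: "real set \<Rightarrow> real set \<Rightarrow> real set \<Rightarrow> (real^3) set" where
  "box3 I1 I2 I3 = {p. p$1 \<in> I1 \<and> p$2 \<in> I2 \<and> p$3 \<in> I3}"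

definition diag_metric :: "(real^3 \<Rightarrow> real) \<Rightarrow> (real^3 \<Rightarrow> real) \<Rightarrow> bilinear_field" where
  "diag_metric f1 f2 p v w =
     1 / (f1 p)\<^sup>2 * (v$1 * w$1) + 1 / (f2 p)\<^sup>2 * (v$2 * w$2) + v$3 * w$3"

definition frame :: "(real^3 \<Rightarrow> real) \<Rightarrow> (real^3 \<Rightarrow> real) \<Rightarrow> 3 \<Rightarrow> vfield" where
  "frame f1 f2 k p =
     (if k = 1 then f1 p *\<^sub>R coord_field 1 p
      else if k = 2 then f2 p *\<^sub>R coord_field 2 p
      else coord_field 3 p)"

definition coframe :: "(real^3 \<Rightarrow> real) \<Rightarrow> (real^3 \<Rightarrow> real) \<Rightarrow> 3 \<Rightarrow> one_form" where
  "coframe f1 f2 k p v = (if k = 1 then v$1 / f1 p else if k = 2 then v$2 / f2 p else v$3)"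

lemma coframe_dual:
  assumes "f1 p \<noteq> 0" "f2 p \<noteq> 0"
  shows "coframe f1 f2 i p (frame f1 f2 j p) = (if i = j then 1 else 0)"
  using assms exhaust_3[of i] exhaust_3[of j]
  by (auto simp: coframe_def frame_def coord_field_def axis_def)

lemma frame_orthonormal:
  assumes "f1 p \<noteq> 0" "f2 p \<noteq> 0"
  shows "diag_metric f1 f2 p (frame f1 f2 i p) (frame f1 f2 j p) = (if i = j then 1 else 0)"
  using assms exhaust_3[of i] exhaust_3[of j]
  by (auto simp: diag_metric_def frame_def coord_field_def axis_def power2_eq_square)

end

theory Submission
  imports Defs
begin

text \<open>The field \<open>\<partial>\<^sub>3\<close> is Killing and parallel, so the Lie derivative and all \<open>Ric(\<cdot>, \<partial>\<^sub>3)\<close> vanish.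
  The \<open>(1,3)\<close> component of the soliton equation is then \<open>\<mu> f\<^sup>2 / f\<^sub>1 = 0\<close>, which gives \<open>\<eta> = 0\<close>, and
  the \<open>(3,3)\<close> component gives \<open>\<lambda> = 0\<close>. What is left of the \<open>(1,1)\<close> component is the vanishing of the
  Gauss curvature of the surface factor, i.e. the sum of a function of \<open>x\<^sup>2\<close> and a function of \<open>x\<^sup>1\<close>
  is zero, and separation of variables makes both constant.\<close>

section \<open>Smooth functions on open sets\<close>

lemma has_derivative_cong_open:
  assumes "open S" "p \<in> S" "\<And>q. q \<in> S \<Longrightarrow> f q = g q"
  shows "(f has_derivative A) (at p) \<longleftrightarrow> (g has_derivative A) (at p)"
proof
  show "(g has_derivative A) (at p)" if "(f has_derivative A) (at p)"
    using has_derivative_transform_within_open[OF that assms] .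
  show "(f has_derivative A) (at p)" if "(g has_derivative A) (at p)"
    using has_derivative_transform_within_open[OF that assms(1,2) assms(3)[symmetric]] .
qed

lemma frechet_derivative_cong_open:
  assumes "open S" "p \<in> S" "\<And>q. q \<in> S \<Longrightarrow> f q = g q"
  shows "frechet_derivative f (at p) = frechet_derivative g (at p)"
  by (simp add: frechet_derivative_def has_derivative_cong_open[OF assms])

text \<open>Fields are total functions that matter only on \<open>S\<close>, so smoothness has to
  pass between functions agreeing there. Openness makes their derivatives agree on \<open>S\<close>
  too, which feeds the induction; hence both functions are generalized.\<close>

lemma Ck_on_cong:
  assumes "open S" "\<And>p. p \<in> S \<Longrightarrow> f p = g p" "Ck_on k S f"
  shows "Ck_on k S g"
  using assms(2,3)
proof (induction k arbitrary: f g)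
  case 0
  then show ?case
    using continuous_on_eq[of S f g] by simp
next
  case (Suc k)
  have eq: "frechet_derivative f (at p) = frechet_derivative g (at p)"
      "(f has_derivative A) (at p) \<longleftrightarrow> (g has_derivative A) (at p)" if "p \<in> S" for p A
    using Suc.prems(1)
    by (intro frechet_derivative_cong_open[OF assms(1) that] has_derivative_cong_open[OF assms(1) that]; simp)+
  have "g differentiable (at p)" if "p \<in> S" for p
    using Suc.prems(2) that by (simp add: differentiable_def eq(2))
  moreover have "Ck_on k S (\<lambda>p. frechet_derivative g (at p) v)" for v
    by (rule Suc.IH[of "\<lambda>p. frechet_derivative f (at p) v"]) (use Suc.prems(2) in \<open>simp_all add: eq(1)\<close>)
  ultimately show ?case
    by simp
qed

lemma smooth_on_cong:
  assumes "open S" "\<And>p. p \<in> S \<Longrightarrow> f p = g p" "smooth_on S f"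
  shows "smooth_on S g"
  using assms Ck_on_cong unfolding smooth_on_def by metis

lemma smooth_on_const: "smooth_on S (\<lambda>p. c)"
proof -
  have "Ck_on k S (\<lambda>p. c)" for k
    by (induction k arbitrary: c) auto
  then show ?thesis
    by (simp add: smooth_on_def)
qed

lemma smooth_on_continuous: "smooth_on S f \<Longrightarrow> continuous_on S f"
  unfolding smooth_on_def by (metis Ck_on.simps(1))

lemma smooth_on_differentiable:
  "smooth_on S f \<Longrightarrow> p \<in> S \<Longrightarrow> f differentiable (at p)"
  unfolding smooth_on_def by (metis Ck_on.simps(2))

lemma smooth_on_frechet_derivative:
  "smooth_on S f \<Longrightarrow> smooth_on S (\<lambda>p. frechet_derivative f (at p) v)"
  unfolding smooth_on_def by (metis Ck_on.simps(2))

lemma has_frechet_derivative: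
  "smooth_on S f \<Longrightarrow> p \<in> S \<Longrightarrow> (f has_derivative frechet_derivative f (at p)) (at p)"
  using smooth_on_differentiable frechet_derivative_works by blast

text \<open>Differentiation commutes with \<open>L\<close>, so each derivative has the same shape
  with another smooth function inside. Induction over all smooth \<open>f\<close> then works.
  Negation, components and multiples of a fixed vector are instances.\<close>

lemma smooth_on_bounded_linear:
  fixes f :: "'a::real_normed_vector \<Rightarrow> 'b::real_normed_vector"
  assumes L: "bounded_linear L" and "open S" "smooth_on S f"
  shows "smooth_on S (\<lambda>p. L (f p))"
proof -
  have "Ck_on k S (\<lambda>p. L (f p))" if "smooth_on S f" for k and f :: "'a \<Rightarrow> 'b"
    using that
  proof (induction k arbitrary: f)
    case 0
    then show ?case
      using bounded_linear.continuous_on[OF L smooth_on_continuous] by simp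
  next
    case (Suc k)
    have d: "((\<lambda>p. L (f p)) has_derivative (\<lambda>v. L (frechet_derivative f (at p) v))) (at p)"
      if "p \<in> S" for p
      using bounded_linear.has_derivative[OF L has_frechet_derivative[OF Suc.prems that]] .
    have "Ck_on k S (\<lambda>p. frechet_derivative (\<lambda>p. L (f p)) (at p) v)" for v
      using Suc.IH[OF smooth_on_frechet_derivative[OF Suc.prems, of v]]
      by (rule Ck_on_cong[OF \<open>open S\<close>, rotated]) (simp add: frechet_derivative_at[OF d, symmetric])
    with d show ?case
      unfolding Ck_on.simps differentiable_def by blast
  qed
  with assms(3) show ?thesis
    by (simp add: smooth_on_def)
qed

lemma smooth_on_add:
  fixes f g :: "'a::real_normed_vector \<Rightarrow> 'b::real_normed_vector"
  assumes "open S" "smooth_on S f" "smooth_on S g"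
  shows "smooth_on S (\<lambda>p. f p + g p)"
proof -
  have "Ck_on k S (\<lambda>p. f p + g p)" if "smooth_on S f" "smooth_on S g" for k and f g :: "'a \<Rightarrow> 'b"
    using that
  proof (induction k arbitrary: f g)
    case 0
    then show ?case
      by (simp add: continuous_on_add smooth_on_continuous)
  next
    case (Suc k)
    have d: "((\<lambda>p. f p + g p) has_derivative
        (\<lambda>v. frechet_derivative f (at p) v + frechet_derivative g (at p) v)) (at p)"
      if "p \<in> S" for p
      using Suc.prems that by (intro has_derivative_add has_frechet_derivative)
    have "Ck_on k S (\<lambda>p. frechet_derivative (\<lambda>p. f p + g p) (at p) v)" for v
      using Suc.IH[OF smooth_on_frechet_derivative[OF Suc.prems(1), of v]
        smooth_on_frechet_derivative[OF Suc.prems(2), of v]]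
      by (rule Ck_on_cong[OF \<open>open S\<close>, rotated]) (simp add: frechet_derivative_at[OF d, symmetric])
    with d show ?case
      unfolding Ck_on.simps differentiable_def by blast
  qed
  with assms(2,3) show ?thesis
    by (simp add: smooth_on_def)
qed

lemma smooth_on_minus: "open S \<Longrightarrow> smooth_on S f \<Longrightarrow> smooth_on S (\<lambda>p. - f p)"
  by (rule smooth_on_bounded_linear[OF bounded_linear_minus[OF bounded_linear_ident]])

lemma smooth_on_scaleR_left:
  "open S \<Longrightarrow> smooth_on S h \<Longrightarrow> smooth_on S (\<lambda>p. h p *\<^sub>R v)"
  by (rule smooth_on_bounded_linear[OF bounded_linear_scaleR_left])

lemma smooth_on_component:
  fixes X :: "'a::real_normed_vector \<Rightarrow> real^'n"
  shows "open S \<Longrightarrow> smooth_on S X \<Longrightarrow> smooth_on S (\<lambda>p. X p $ i)"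
  by (rule smooth_on_bounded_linear[OF bounded_linear_vec_nth])

lemma smooth_on_coord_field: "smooth_on S (coord_field i)"
  unfolding coord_field_def by (rule smooth_on_const)

lemma coord_field_scaleR_smooth:
  "open S \<Longrightarrow> smooth_on S h \<Longrightarrow> smooth_on S (\<lambda>p. h p *\<^sub>R coord_field i p)"
  unfolding coord_field_def by (rule smooth_on_scaleR_left)

section \<open>Directional derivatives\<close>

lemma vderiv_eqI:
  assumes "open S" "p \<in> S" "\<And>q. q \<in> S \<Longrightarrow> F q = H q" "(H has_derivative H') (at p)"
  shows "vderiv X F p = H' (X p)"
  using frechet_derivative_cong_open[OF assms(1-3)] frechet_derivative_at[OF assms(4)]
  by (simp add: vderiv_def)

lemma vderiv_const [simp]: "vderiv X (\<lambda>q. c) p = 0"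
  by (simp add: vderiv_def)

lemma coord_field_nth: "coord_field i p $ j = (if j = i then 1 else 0)"
  by (simp add: coord_field_def axis_def)

lemma vderiv_coord_field [simp]: "vderiv X (coord_field i) p = 0"
  by (simp add: coord_field_def)

lemma lie_bracket_coord_field [simp]: "lie_bracket (coord_field i) (coord_field j) p = 0"
  by (simp add: lie_bracket_def)

text \<open>Nothing is assumed about the regularity of \<open>h\<close>: it is obtained by
  restricting \<open>F\<close> to the line through \<open>p\<close> in direction
  \<open>axis i 1\<close>, where \<open>F\<close> agrees with \<open>h\<close> near
  \<open>p $ i\<close>.\<close>

lemma function_of_coordinate_derivative:
  fixes F :: "real^'n \<Rightarrow> real"
  assumes "open S" "p \<in> S" "F differentiable (at p)" "\<And>q. q \<in> S \<Longrightarrow> F q = h (q $ i)"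
  shows "(h has_real_derivative frechet_derivative F (at p) (axis i 1)) (at (p $ i))"
proof -
  define l where "l t = p + (t - p $ i) *\<^sub>R axis i (1::real)" for t
  have l0: "l (p $ i) = p"
    by (simp add: l_def)
  have dl: "(l has_derivative (\<lambda>t. t *\<^sub>R axis i 1)) (at (p $ i))"
    unfolding l_def by (auto intro!: derivative_eq_intros)
  have "(F has_derivative frechet_derivative F (at p)) (at (l (p $ i)))"
    using assms(3) frechet_derivative_works l0 by metis
  from has_derivative_compose[OF dl this]
  have "((\<lambda>t. F (l t)) has_derivative (\<lambda>t. frechet_derivative F (at p) (t *\<^sub>R axis i 1))) (at (p $ i))" .
  moreover have "frechet_derivative F (at p) (t *\<^sub>R axis i 1) = frechet_derivative F (at p) (axis i 1) * t" for t
    using linear_frechet_derivative[OF assms(3)] by (simp add: linear_cmul)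
  then have "(\<lambda>t. frechet_derivative F (at p) (t *\<^sub>R axis i 1)) = (*) (frechet_derivative F (at p) (axis i 1))"
    by (rule ext)
  ultimately have "((\<lambda>t. F (l t)) has_derivative (*) (frechet_derivative F (at p) (axis i 1))) (at (p $ i))"
    by simp
  moreover have "open (l -` S)"
    using assms(1) unfolding l_def by (intro open_vimage continuous_intros)
  moreover have "F (l t) = h t" if "t \<in> l -` S" for t
    using assms(4)[of "l t"] that by (simp add: l_def)
  ultimately show ?thesis
    unfolding has_field_derivative_def
    using has_derivative_transform_within_open[of "\<lambda>t. F (l t)" _ "p $ i" UNIV "l -` S" h] l0 assms(2)
    by simp
qed

text \<open>The \<open>i\<close>-th partial derivative of \<open>F\<close> is again smooth and, on
  \<open>S\<close>, again a function of coordinate \<open>i\<close> alone, namely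
  \<open>deriv h\<close>. The previous lemma therefore applies a second time.\<close>

lemma smooth_function_of_coordinate_derivatives:
  fixes F :: "real^'n \<Rightarrow> real"
  assumes "open S" "smooth_on S F" "\<And>q. q \<in> S \<Longrightarrow> F q = h (q $ i)" "p \<in> S"
  shows "(h has_real_derivative deriv h (p $ i)) (at (p $ i))"
    and "(deriv h has_real_derivative deriv (deriv h) (p $ i)) (at (p $ i))"
proof -
  have d: "(h has_real_derivative frechet_derivative F (at q) (axis i 1)) (at (q $ i))" if "q \<in> S" for q
    using function_of_coordinate_derivative smooth_on_differentiable assms that by blast
  then have e: "frechet_derivative F (at q) (axis i 1) = deriv h (q $ i)" if "q \<in> S" for q
    using that by (metis DERIV_imp_deriv)
  show "(h has_real_derivative deriv h (p $ i)) (at (p $ i))"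
    using d e assms(4) by metis
  have "(deriv h has_real_derivative
      frechet_derivative (\<lambda>q. frechet_derivative F (at q) (axis i 1)) (at p) (axis i 1)) (at (p $ i))"
    using smooth_on_differentiable[OF smooth_on_frechet_derivative[OF assms(2)] assms(4)] e
    by (intro function_of_coordinate_derivative[OF assms(1,4)])
  then show "(deriv h has_real_derivative deriv (deriv h) (p $ i)) (at (p $ i))"
    using DERIV_imp_deriv by metis
qed

lemma has_derivative_of_coordinate:
  assumes "(h has_real_derivative d) (at (p $ i))"
  shows "((\<lambda>q::real^'n. h (q $ i)) has_derivative (\<lambda>v. d * v $ i)) (at p)"
  using has_derivative_compose[OF bounded_linear_imp_has_derivative[OF bounded_linear_vec_nth]]
    assms unfolding has_field_derivative_def by blast

lemma DERIV_inverse_square: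
  fixes h :: "real \<Rightarrow> real"
  assumes "(h has_real_derivative d) (at t)" "h t \<noteq> 0"
  shows "((\<lambda>t. 1 / (h t)\<^sup>2) has_real_derivative - 2 * d / h t ^ 3) (at t)"
  using assms by (auto intro!: derivative_eq_intros simp: field_simps power_numeral_reduce)

section \<open>Affine connections in coordinates\<close>

lemma vfield_coord_expansion:
  "(X::vfield) = (\<lambda>p. X p $ 1 *\<^sub>R coord_field 1 p +
     (X p $ 2 *\<^sub>R coord_field 2 p + X p $ 3 *\<^sub>R coord_field 3 p))"
  by (rule ext) (simp add: coord_field_def vec_eq_iff forall_3 axis_def)

locale affine_connection_on =
  fixes S :: "(real^3) set" and D :: connection
  assumes open_S: "open S" and affine: "affine_connection S D"
begin

lemmas affineD = affine[unfolded affine_connection_def]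
lemmas smooth_D = affineD[THEN conjunct1, rule_format]
lemmas D_add_left = affineD[THEN conjunct2, THEN conjunct1, rule_format]
lemmas D_scaleR_left = affineD[THEN conjunct2, THEN conjunct2, THEN conjunct1, rule_format]
lemmas D_add_right = affineD[THEN conjunct2, THEN conjunct2, THEN conjunct2, THEN conjunct1, rule_format]
lemmas D_scaleR_right = affineD[THEN conjunct2, THEN conjunct2, THEN conjunct2, THEN conjunct2, rule_format]

lemmas smooth_parts = smooth_on_coord_field smooth_on_component[OF open_S]
  coord_field_scaleR_smooth[OF open_S] smooth_on_add[OF open_S]

lemma D_expand_left:
  assumes "smooth_on S X" "smooth_on S Y" "p \<in> S"
  shows "D X Y p = (\<Sum>i\<in>UNIV. X p $ i *\<^sub>R D (coord_field i) Y p)"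
  by (rule trans[OF arg_cong[OF vfield_coord_expansion[of X], of "\<lambda>X. D X Y p"]])
    (simp add: assms smooth_parts D_add_left D_scaleR_left sum_3)

lemma D_expand_right:
  assumes "smooth_on S X" "smooth_on S Y" "p \<in> S"
  shows "D X Y p = (\<Sum>i\<in>UNIV. vderiv X (\<lambda>q. Y q $ i) p *\<^sub>R coord_field i p
      + Y p $ i *\<^sub>R D X (coord_field i) p)"
  by (rule trans[OF arg_cong[OF vfield_coord_expansion[of Y], of "\<lambda>Y. D X Y p"]])
    (simp add: assms smooth_parts D_add_right D_scaleR_right sum_3)

text \<open>The expansion in coordinate fields involves \<open>X\<close> only through its components
  at \<open>p\<close>.\<close>

lemma D_cong_left:
  assumes "smooth_on S X" "smooth_on S X'" "smooth_on S Y" "p \<in> S" "X p = X' p"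
  shows "D X Y p = D X' Y p"
  using assms by (simp add: D_expand_left)

text \<open>Locality in the differentiated field, read off from the Leibniz expansion: only the
  values and first derivatives of the components at \<open>p\<close> enter, and these depend only on
  \<open>Y\<close> over the open set \<open>S\<close>.\<close>

lemma D_cong_right:
  assumes "smooth_on S X" "smooth_on S Y" "\<And>q. q \<in> S \<Longrightarrow> Y q = Y' q" "p \<in> S"
  shows "D X Y p = D X Y' p"
proof -
  have "smooth_on S Y'"
    using smooth_on_cong[OF open_S assms(3,2)] .
  moreover have "vderiv X (\<lambda>q. Y q $ i) p = vderiv X (\<lambda>q. Y' q $ i) p" for i
    unfolding vderiv_def using frechet_derivative_cong_open[OF open_S assms(4)] assms(3) by metis
  ultimately show ?thesis
    using assms by (simp add: D_expand_right)
qed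

text \<open>The Leibniz rule applied to the inner field written in coordinate fields: the derivative
  of a Christoffel symbol plus a sum of products of two of them.\<close>

lemma D_coord_coord_component:
  assumes "p \<in> S"
  shows "D (coord_field i) (D (coord_field j) (coord_field l)) p $ m =
    vderiv (coord_field i) (\<lambda>q. D (coord_field j) (coord_field l) q $ m) p +
    (\<Sum>n\<in>UNIV. D (coord_field j) (coord_field l) p $ n * D (coord_field i) (coord_field n) p $ m)"
  using exhaust_3[of m]
  by (auto simp: D_expand_right[of "coord_field i" "D (coord_field j) (coord_field l)"] smooth_D
      smooth_on_coord_field assms sum_3 coord_field_nth)

text \<open>Needed because the frame fields are function multiples of coordinate fields. The bracket
  of \<open>h\<close> times field \<open>i\<close> with field \<open>j\<close> is minus the
  \<open>j\<close>-derivative of \<open>h\<close> times field \<open>i\<close>; its contribution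
  cancels the Leibniz term of the second covariant derivative.\<close>

lemma curvature_scaleR_coord_field:
  assumes h: "smooth_on S h" and Z: "smooth_on S Z" and p: "p \<in> S"
  shows "curvature D (\<lambda>q. h q *\<^sub>R coord_field i q) (coord_field j) Z p =
    h p *\<^sub>R (D (coord_field i) (D (coord_field j) Z) p - D (coord_field j) (D (coord_field i) Z) p)"
proof -
  let ?X = "\<lambda>q. h q *\<^sub>R coord_field i q"
  let ?k = "\<lambda>q. - vderiv (coord_field j) h q"
  have X: "smooth_on S ?X"
    using h by (simp add: smooth_parts)
  have k: "smooth_on S ?k"
    unfolding vderiv_def coord_field_def
    by (intro smooth_on_minus[OF open_S] smooth_on_frechet_derivative h)
  have br: "?k q *\<^sub>R coord_field i q = lie_bracket ?X (coord_field j) q" if "q \<in> S" for q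
  proof -
    have "(?X has_derivative (\<lambda>v. frechet_derivative h (at q) v *\<^sub>R axis i 1)) (at q)"
      unfolding coord_field_def
      by (intro has_derivative_scaleR_left has_frechet_derivative[OF h that])
    then have "vderiv (coord_field j) ?X q = vderiv (coord_field j) h q *\<^sub>R coord_field i q"
      by (simp add: vderiv_def coord_field_def flip: frechet_derivative_at)
    then show ?thesis
      by (simp add: lie_bracket_def)
  qed
  have "smooth_on S (lie_bracket ?X (coord_field j))"
    by (rule smooth_on_cong[OF open_S _ coord_field_scaleR_smooth[OF open_S k, of i]]) (rule br)
  then have "D (lie_bracket ?X (coord_field j)) Z p = D (\<lambda>q. ?k q *\<^sub>R coord_field i q) Z p"
    using D_cong_left[where X' = "\<lambda>q. ?k q *\<^sub>R coord_field i q", OF _ _ Z p]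
      coord_field_scaleR_smooth[OF open_S k, of i] br[OF p] by metis
  also have "\<dots> = ?k p *\<^sub>R D (coord_field i) Z p"
    using D_scaleR_left[OF k smooth_on_coord_field Z p, of i] .
  finally have 1: "D (lie_bracket ?X (coord_field j)) Z p = ?k p *\<^sub>R D (coord_field i) Z p" .
  have "D (coord_field j) (D ?X Z) p = D (coord_field j) (\<lambda>q. h q *\<^sub>R D (coord_field i) Z q) p"
    by (rule D_cong_right[where X = "coord_field j" and Y = "D ?X Z"
          and Y' = "\<lambda>q. h q *\<^sub>R D (coord_field i) Z q"])
      (use D_scaleR_left[OF h smooth_on_coord_field Z] smooth_D[OF X Z] p smooth_on_coord_field in simp_all)
  also have "\<dots> = vderiv (coord_field j) h p *\<^sub>R D (coord_field i) Z p
      + h p *\<^sub>R D (coord_field j) (D (coord_field i) Z) p"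
    by (rule D_scaleR_right[where X = "coord_field j" and Y = "D (coord_field i) Z"])
      (use h p smooth_D[OF smooth_on_coord_field Z] smooth_on_coord_field in simp_all)
  finally have 2: "D (coord_field j) (D ?X Z) p = vderiv (coord_field j) h p *\<^sub>R D (coord_field i) Z p
      + h p *\<^sub>R D (coord_field j) (D (coord_field i) Z) p" .
  have 3: "D ?X (D (coord_field j) Z) p = h p *\<^sub>R D (coord_field i) (D (coord_field j) Z) p"
    using D_scaleR_left[OF h smooth_on_coord_field smooth_D[OF smooth_on_coord_field Z] p] .
  show ?thesis
    unfolding curvature_def 1 2 3 by (simp add: scaleR_diff_right)
qed

end

section \<open>Curvature of the diagonal metric\<close>

text \<open>All curvature computations are local, so \<open>S\<close> is any open set here; the
  product structure of the box enters only when the variables are separated.\<close>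

locale diag_metric_connection =
  fixes S :: "(real^3) set" and D :: connection and f1 f2 :: "real^3 \<Rightarrow> real" and h1 h2 :: "real \<Rightarrow> real"
  assumes open_box: "open S" and lc: "levi_civita S (diag_metric f1 f2) D"
    and smooth1: "smooth_on S f1" and smooth2: "smooth_on S f2"
    and nz1: "\<And>p. p \<in> S \<Longrightarrow> f1 p \<noteq> 0" and nz2: "\<And>p. p \<in> S \<Longrightarrow> f2 p \<noteq> 0"
    and f1_eq: "\<And>p. p \<in> S \<Longrightarrow> f1 p = h1 (p $ 2)" and f2_eq: "\<And>p. p \<in> S \<Longrightarrow> f2 p = h2 (p $ 1)"
begin

sublocale affine_connection_on S D
  using open_box lc by unfold_locales (auto simp: levi_civita_def)

abbreviation G :: "3 \<Rightarrow> 3 \<Rightarrow> vfield" where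
  "G i j \<equiv> D (coord_field i) (coord_field j)"

abbreviation gc :: "3 \<Rightarrow> 3 \<Rightarrow> real^3 \<Rightarrow> real" where
  "gc i j \<equiv> \<lambda>q. diag_metric f1 f2 q (coord_field i q) (coord_field j q)"

section \<open>Christoffel symbols of the metric\<close>

lemma h_deriv:
  assumes "p \<in> S"
  shows "(h1 has_real_derivative deriv h1 (p $ 2)) (at (p $ 2))"
    and "(deriv h1 has_real_derivative deriv (deriv h1) (p $ 2)) (at (p $ 2))"
    and "(h2 has_real_derivative deriv h2 (p $ 1)) (at (p $ 1))"
    and "(deriv h2 has_real_derivative deriv (deriv h2) (p $ 1)) (at (p $ 1))"
  by (rule smooth_function_of_coordinate_derivatives[OF open_box smooth1 _ assms]
      smooth_function_of_coordinate_derivatives[OF open_box smooth2 _ assms]; simp add: f1_eq f2_eq)+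

lemma h_nz: "p \<in> S \<Longrightarrow> h1 (p $ 2) \<noteq> 0" "p \<in> S \<Longrightarrow> h2 (p $ 1) \<noteq> 0"
  using nz1 nz2 f1_eq f2_eq by metis+

lemma vderiv_metric:
  assumes p: "p \<in> S"
  shows "vderiv (coord_field k) (gc i j) p =
    (if i = 1 \<and> j = 1 \<and> k = 2 then - 2 * deriv h1 (p $ 2) / h1 (p $ 2) ^ 3
     else if i = 2 \<and> j = 2 \<and> k = 1 then - 2 * deriv h2 (p $ 1) / h2 (p $ 1) ^ 3 else 0)"
proof -
  have "((\<lambda>t. 1 / (h1 t)\<^sup>2) has_real_derivative - 2 * deriv h1 (p $ 2) / h1 (p $ 2) ^ 3) (at (p $ 2))"
    by (rule DERIV_inverse_square[OF h_deriv(1) h_nz(1), OF p p])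
  note 1 = has_derivative_of_coordinate[OF this]
  have "((\<lambda>t. 1 / (h2 t)\<^sup>2) has_real_derivative - 2 * deriv h2 (p $ 1) / h2 (p $ 1) ^ 3) (at (p $ 1))"
    by (rule DERIV_inverse_square[OF h_deriv(3) h_nz(2), OF p p])
  note 2 = has_derivative_of_coordinate[OF this]
  have "vderiv (coord_field k) (gc 1 1) p = - 2 * deriv h1 (p $ 2) / h1 (p $ 2) ^ 3 * coord_field k p $ 2"
    by (rule vderiv_eqI[OF open_box p _ 1]) (simp add: diag_metric_def coord_field_nth f1_eq)
  moreover have "vderiv (coord_field k) (gc 2 2) p = - 2 * deriv h2 (p $ 1) / h2 (p $ 1) ^ 3 * coord_field k p $ 1"
    by (rule vderiv_eqI[OF open_box p _ 2]) (simp add: diag_metric_def coord_field_nth f2_eq)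
  \<comment> \<open>The off-diagonal components and the last diagonal one are constant on the whole
    space, so they can be rewritten as functions, without restriction to \<open>S\<close>.\<close>
  moreover have "vderiv (coord_field k) (gc i j) p = 0" if "i \<noteq> j \<or> i = 3"
  proof -
    have "gc i j = (\<lambda>q. if i = j then 1 else 0)"
      using that exhaust_3[of i] exhaust_3[of j]
      by (intro ext) (elim disjE; simp add: diag_metric_def coord_field_nth)
    then show ?thesis
      by simp
  qed
  ultimately show ?thesis
    using exhaust_3[of i] exhaust_3[of j] exhaust_3[of k] by (auto simp: coord_field_nth)
qed

text \<open>The Koszul formula has no bracket terms here because coordinate fields commute. Metric
  compatibility turns the right side into six terms; by the symmetry of \<open>G\<close>, four
  cancel and two coincide.\<close>

lemma koszul:
  assumes p: "p \<in> S"
  shows "2 * diag_metric f1 f2 p (G i j p) (coord_field k p) =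
    vderiv (coord_field i) (gc j k) p + vderiv (coord_field j) (gc i k) p
    - vderiv (coord_field k) (gc i j) p"
proof -
  have sym: "diag_metric f1 f2 p v w = diag_metric f1 f2 p w v" for v w
    by (simp add: diag_metric_def mult.commute)
  have "G i j p - G j i p = 0" for i j
    using lc[unfolded levi_civita_def, THEN conjunct2, THEN conjunct1, rule_format,
        OF smooth_on_coord_field smooth_on_coord_field p] by simp
  then have tor: "G i j p = G j i p" for i j
    by (simp add: right_minus_eq)
  have comp: "vderiv (coord_field i) (gc j k) p =
      diag_metric f1 f2 p (G i j p) (coord_field k p) + diag_metric f1 f2 p (G i k p) (coord_field j p)" for i j k
    unfolding sym[of "G i k p"]
    by (rule lc[unfolded levi_civita_def, THEN conjunct2, THEN conjunct2, rule_format,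
        OF smooth_on_coord_field smooth_on_coord_field smooth_on_coord_field p])
  show ?thesis
    unfolding comp tor[of j i] tor[of k i] tor[of k j] by simp
qed

text \<open>As the metric is diagonal, pairing with \<open>coord_field k\<close> isolates component
  \<open>k\<close> up to the nonzero factor \<open>gc k k p\<close>. Dividing the Koszul formula by
  it leaves a check of the 27 index triples.\<close>

lemma christoffel:
  assumes p: "p \<in> S"
  shows "G i j p $ k =
    (if i = 1 \<and> j = 1 \<and> k = 2 then deriv h1 (p $ 2) * (h2 (p $ 1))\<^sup>2 / h1 (p $ 2) ^ 3
     else if i = 2 \<and> j = 2 \<and> k = 1 then deriv h2 (p $ 1) * (h1 (p $ 2))\<^sup>2 / h2 (p $ 1) ^ 3
     else if {i, j} = {1, 2} \<and> k = 1 then - deriv h1 (p $ 2) / h1 (p $ 2)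
     else if {i, j} = {1, 2} \<and> k = 2 then - deriv h2 (p $ 1) / h2 (p $ 1) else 0)"
proof -
  have g: "gc 1 1 p = 1 / (h1 (p $ 2))\<^sup>2" "gc 2 2 p = 1 / (h2 (p $ 1))\<^sup>2" "gc 3 3 p = 1"
    using p by (simp_all add: diag_metric_def coord_field_nth f1_eq f2_eq)
  have "gc k k p \<noteq> 0"
    using exhaust_3[of k] g h_nz[OF p] by auto
  moreover have "diag_metric f1 f2 p (G i j p) (coord_field k p) = G i j p $ k * gc k k p"
    using exhaust_3[of k] by (auto simp: diag_metric_def coord_field_nth)
  ultimately have "G i j p $ k = (2 * diag_metric f1 f2 p (G i j p) (coord_field k p)) / (2 * gc k k p)"
    by (simp only:) simp
  then have "G i j p $ k = (vderiv (coord_field i) (gc j k) p + vderiv (coord_field j) (gc i k) p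
      - vderiv (coord_field k) (gc i j) p) / (2 * gc k k p)"
    unfolding koszul[OF p] .
  then show ?thesis
    using exhaust_3[of i] exhaust_3[of j] exhaust_3[of k] h_nz[OF p]
    by (elim disjE; simp add: vderiv_metric[OF p] g doubleton_eq_iff;
        simp add: field_simps power_numeral_reduce)
qed

section \<open>The Ricci tensor on coordinate fields\<close>

lemma ricci_coord:
  assumes p: "p \<in> S"
  shows "ricci (diag_metric f1 f2) D (frame f1 f2) (coord_field j) (coord_field l) p =
    (\<Sum>k\<in>UNIV. (D (coord_field k) (G j l) p - D (coord_field j) (G k l) p) $ k)"
proof -
  define \<phi> where "\<phi> k = (if k = 1 then f1 else if k = 2 then f2 else (\<lambda>q. 1))" for k :: 3
  have fr: "frame f1 f2 k = (\<lambda>q. \<phi> k q *\<^sub>R coord_field k q)" for k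
    using exhaust_3[of k] by (auto simp: frame_def \<phi>_def fun_eq_iff)
  have "smooth_on S (\<phi> k)" for k
    by (simp add: \<phi>_def smooth1 smooth2 smooth_on_const)
  then have "curvature D (frame f1 f2 k) (coord_field j) (coord_field l) p =
      \<phi> k p *\<^sub>R (D (coord_field k) (G j l) p - D (coord_field j) (G k l) p)" for k
    unfolding fr using p by (intro curvature_scaleR_coord_field smooth_on_coord_field)
  \<comment> \<open>The two factors \<open>\<phi> k p\<close> cancel against the metric coefficient,
    so the trace over the orthonormal frame becomes the coordinate trace.\<close>
  moreover have "diag_metric f1 f2 p (\<phi> k p *\<^sub>R v) (frame f1 f2 k p) = v $ k" for k v
    using exhaust_3[of k] nz1[OF p] nz2[OF p]
    by (auto simp: fr \<phi>_def diag_metric_def coord_field_nth power2_eq_square)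
  ultimately show ?thesis
    by (simp add: ricci_def)
qed

lemma vderiv_christoffel_zero:
  assumes p: "p \<in> S" and "\<And>q. q \<in> S \<Longrightarrow> G i j q $ k = 0"
  shows "vderiv X (\<lambda>q. G i j q $ k) p = 0"
  using vderiv_eqI[OF open_box p assms(2) has_derivative_const] .

lemma ricci_coord_3:
  assumes p: "p \<in> S"
  shows "ricci (diag_metric f1 f2) D (frame f1 f2) (coord_field j) (coord_field 3) p = 0"
proof -
  \<comment> \<open>This is the parallelism of \<open>coord_field 3\<close>; every term of the Ricci
    trace differentiates it at least once.\<close>
  have z: "G i 3 q $ k = 0" if "q \<in> S" for i k q
    using that exhaust_3[of i] by (auto simp: christoffel doubleton_eq_iff)
  have "D (coord_field i) (G j 3) p $ m = 0" for i j m
    by (simp add: D_coord_coord_component[OF p] vderiv_christoffel_zero[OF p z] z p)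
  then show ?thesis
    by (simp add: ricci_coord[OF p])
qed

text \<open>The right side is K / \<open>a\<^sup>2\<close>, where K is the Gauss curvature of the
  surface factor, whose first metric coefficient is 1 / \<open>a\<^sup>2\<close>.\<close>

lemma ricci_coord_1_1:
  assumes p: "p \<in> S"
  defines "a \<equiv> h1 (p $ 2)" and "b \<equiv> h2 (p $ 1)"
  shows "ricci (diag_metric f1 f2) D (frame f1 f2) (coord_field 1) (coord_field 1) p =
    b\<^sup>2 * ((deriv (deriv h1) (p $ 2) * a - 2 * (deriv h1 (p $ 2))\<^sup>2) / a ^ 4
      + (deriv (deriv h2) (p $ 1) * b - 2 * (deriv h2 (p $ 1))\<^sup>2) / b ^ 4)"
proof -
  have nz: "h1 (p $ 2) \<noteq> 0" "h2 (p $ 1) \<noteq> 0"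
    using h_nz[OF p] .
  have "((\<lambda>t. deriv h1 t / h1 t ^ 3) has_real_derivative
      (deriv (deriv h1) (p $ 2) * a - 3 * (deriv h1 (p $ 2))\<^sup>2) / a ^ 4) (at (p $ 2))"
    using h_deriv(1,2)[OF p] nz(1) unfolding a_def
    by (auto intro!: derivative_eq_intros simp: divide_simps) (simp add: eval_nat_numeral algebra_simps)
  moreover have "((\<lambda>t. (h2 t)\<^sup>2) has_real_derivative 2 * b * deriv h2 (p $ 1)) (at (p $ 1))"
    using h_deriv(3)[OF p] unfolding b_def by (auto intro!: derivative_eq_intros)
  \<comment> \<open>The differentiated function is \<open>G 1 1 q $ 2\<close>, split into a factor
    in each variable so that one-variable derivatives suffice.\<close>
  ultimately have "((\<lambda>q. deriv h1 (q $ 2) / h1 (q $ 2) ^ 3 * (h2 (q $ 1))\<^sup>2) has_derivative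
      (\<lambda>v. deriv h1 (p $ 2) / h1 (p $ 2) ^ 3 * (2 * b * deriv h2 (p $ 1) * v $ 1) +
        (deriv (deriv h1) (p $ 2) * a - 3 * (deriv h1 (p $ 2))\<^sup>2) / a ^ 4 * v $ 2 * (h2 (p $ 1))\<^sup>2)) (at p)"
    by (intro has_derivative_mult has_derivative_of_coordinate)
  from vderiv_eqI[OF open_box p _ this]
  have 2: "vderiv (coord_field 2) (\<lambda>q. G 1 1 q $ 2) p =
      b\<^sup>2 * (deriv (deriv h1) (p $ 2) * a - 3 * (deriv h1 (p $ 2))\<^sup>2) / a ^ 4"
    by (simp add: christoffel coord_field_nth b_def)
  have "((\<lambda>t. - deriv h2 t / h2 t) has_real_derivative
      - (deriv (deriv h2) (p $ 1) * b - (deriv h2 (p $ 1))\<^sup>2) / b\<^sup>2) (at (p $ 1))"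
    using h_deriv(3,4)[OF p] nz(2) unfolding b_def
    by (auto intro!: derivative_eq_intros simp: divide_simps) (simp add: eval_nat_numeral algebra_simps)
  note d = has_derivative_of_coordinate[OF this]
  have 1: "vderiv (coord_field 1) (\<lambda>q. G 2 1 q $ 2) p =
      - (deriv (deriv h2) (p $ 1) * b - (deriv h2 (p $ 1))\<^sup>2) / b\<^sup>2"
    using vderiv_eqI[OF open_box p _ d, of "\<lambda>q. G 2 1 q $ 2" "coord_field 1"]
    by (simp add: christoffel coord_field_nth doubleton_eq_iff)
  have 3: "vderiv X (\<lambda>q. G 1 1 q $ 3) p = 0" "vderiv X (\<lambda>q. G 3 1 q $ 3) p = 0" for X
    by (rule vderiv_christoffel_zero[OF p]; simp add: christoffel)+
  \<comment> \<open>Only the summand \<open>k = 2\<close> survives: for \<open>k = 1\<close> the two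
    second derivatives are identical, and for \<open>k = 3\<close> all terms vanish. Its quadratic
    Christoffel terms change the coefficients -3 and -1 of the squared derivatives in
    \<open>2\<close> and \<open>1\<close> to the common -2.\<close>
  show ?thesis
    using nz
    by (simp add: ricci_coord[OF p] sum_3 D_coord_coord_component[OF p] 1 2 3 christoffel[OF p]
        doubleton_eq_iff flip: a_def b_def)
      (simp add: field_simps power_numeral_reduce)
qed

text \<open>Coordinate fields commute, and no metric component depends on the third
  coordinate.\<close>

lemma lie_derivative_coord_3:
  assumes p: "p \<in> S"
  shows "lie_derivative (coord_field 3) (diag_metric f1 f2) (coord_field i) (coord_field j) p = 0"
  using vderiv_metric[OF p, of 3 i j] by (simp add: lie_derivative_def diag_metric_def)

end

section \<open>Soliton equation and separation of variables\<close>

theorem proposition3p7: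
  fixes I1 I2 I3 :: "real set"
    and I :: "(real^3) set"
    and f1 f2 f lam \<mu> :: "real^3 \<Rightarrow> real"
    and h1 h2 :: "real \<Rightarrow> real"
    and D :: connection
    and \<eta> :: one_form
    and \<eta>c :: "3 \<Rightarrow> real^3 \<Rightarrow> real"
  assumes "open I1" "is_interval I1" "open I2" "is_interval I2" "open I3" "is_interval I3"
    and "I = box3 I1 I2 I3"
    and "smooth_on I f1" "\<forall>p\<in>I. f1 p \<noteq> 0"
    and "smooth_on I f2" "\<forall>p\<in>I. f2 p \<noteq> 0"
    and "levi_civita I (diag_metric f1 f2) D"
    and "almost_eta_ricci_soliton I (diag_metric f1 f2) D (frame f1 f2) (coord_field 3) \<eta> lam \<mu>"
    and "\<forall>p\<in>I. f1 p = h1 (p$2)"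
    and "\<forall>p\<in>I. f2 p = h2 (p$1)"
    and "\<forall>p\<in>I. \<forall>v. \<eta> p v = (\<Sum>k\<in>UNIV. \<eta>c k p * coframe f1 f2 k p v)"
    and "\<forall>p\<in>I. \<eta>c 1 p = f p \<and> \<eta>c 2 p = f p \<and> \<eta>c 3 p = f p"
    and "\<forall>p\<in>I. \<mu> p \<noteq> 0"
  shows "(\<forall>p\<in>I. \<forall>v. \<eta> p v = 0) \<and> (\<forall>p\<in>I. lam p = 0) \<and>
    (\<exists>c::real. \<forall>p\<in>I.
       (deriv (deriv h1) (p$2) * h1 (p$2) - 2 * (deriv h1 (p$2))\<^sup>2) / h1 (p$2) ^ 4 = c \<and>
       - ((deriv (deriv h2) (p$1) * h2 (p$1) - 2 * (deriv h2 (p$1))\<^sup>2) / h2 (p$1) ^ 4) = c)"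
proof -
  have "I = (\<lambda>p. p $ 1) -` I1 \<inter> ((\<lambda>p. p $ 2) -` I2 \<inter> (\<lambda>p. p $ 3) -` I3)"
    using assms(7) by (auto simp: box3_def)
  then have "open I"
    using assms(1,3,5) by (auto intro!: open_Int open_vimage continuous_intros)
  then interpret diag_metric_connection I D f1 f2 h1 h2
    using assms(8-12,14,15) by unfold_locales auto
  let ?g = "diag_metric f1 f2"
  have sol: "ricci ?g D (frame f1 f2) (coord_field i) (coord_field j) p + lam p * gc i j p
      + \<mu> p * (\<eta> p (coord_field i p) * \<eta> p (coord_field j p)) = 0" if "p \<in> I" for i j p
    using assms(13) that lie_derivative_coord_3[OF that] smooth_on_coord_field
    unfolding almost_eta_ricci_soliton_def by fastforce
  have \<eta>: "\<eta> p v = f p * (v $ 1 / f1 p + v $ 2 / f2 p + v $ 3)" if "p \<in> I" for p v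
    using assms(16,17) that by (simp add: sum_3 coframe_def algebra_simps)
  have f: "f p = 0" if p: "p \<in> I" for p
    using sol[OF p, of 1 3] assms(18) nz1[OF p] p
    by (simp add: ricci_coord_3 \<eta> diag_metric_def coord_field_nth)
  have lam: "lam p = 0" if p: "p \<in> I" for p
    using sol[OF p, of 3 3] p
    by (simp add: ricci_coord_3 \<eta> f diag_metric_def coord_field_nth)
  define A where "A y = (deriv (deriv h1) y * h1 y - 2 * (deriv h1 y)\<^sup>2) / h1 y ^ 4" for y
  define B where "B x = (deriv (deriv h2) x * h2 x - 2 * (deriv h2 x)\<^sup>2) / h2 x ^ 4" for x
  \<comment> \<open>With \<open>lam\<close> and \<open>\<eta>\<close> gone, the (1,1) equation says
    that \<open>(h2 (p $ 1))\<^sup>2\<close> times the sum of \<open>A\<close> and \<open>B\<close>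
    is zero, and the first factor is nonzero.\<close>
  have AB: "A (p $ 2) = - B (p $ 1)" if p: "p \<in> I" for p
    using sol[OF p, of 1 1] h_nz[OF p]
    by (simp add: ricci_coord_1_1[OF p] \<eta> f lam p flip: A_def B_def)
  \<comment> \<open>A base point exists because a soliton has \<open>\<mu>\<close> nonzero somewhere
    on \<open>I\<close>; the constant will be \<open>A (p0 $ 2)\<close>.\<close>
  obtain p0 where p0: "p0 \<in> I"
    using assms(13) unfolding almost_eta_ricci_soliton_def by blast
  have "A (p $ 2) = A (p0 $ 2)" if "p \<in> I" for p
  proof -
    \<comment> \<open>This mixed point lies in the box. It shares its first coordinate with
      \<open>p0\<close> and its second with \<open>p\<close>, so \<open>AB\<close> equates both
      values of \<open>A\<close> with \<open>- B (p0 $ 1)\<close>.\<close>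
    have "vector [p0 $ 1, p $ 2, p $ 3] \<in> I"
      using p0 that by (simp add: assms(7) box3_def)
    from AB[OF this] AB[OF p0] show ?thesis
      by simp
  qed
  then have "\<forall>p\<in>I. A (p $ 2) = A (p0 $ 2) \<and> - B (p $ 1) = A (p0 $ 2)"
    using AB by metis
  then show ?thesis
    using \<eta> f lam unfolding A_def B_def by auto
qed

end
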